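(* Let $(P,+,0)$ be an idempotent commutative monoid (that is, $a+a=a$ for all $a\in P$), let $1\notin P$, and set $S=P\cup\{1\}$. Extend addition to $S$ by $a+1=1+a=1$ for all $a\in S$, and define multiplication on $S$ by $ab=0$ for all $a,b\in P$ and $a\cdot 1=1\cdot a=a$ for all $a\in S$. Then $S$ is a completely primary proper semiring.
   Context: A semiring is an algebraic structure $(S,+,\cdot,0,1)$ such that $(S,+,0)$ and $(S,\cdot,1)$ are commutative monoids, multiplication distributes over addition, and $s\cdot 0=0$ for all $s\in S$. A semiring is proper if it is not a ring. An element $s\in S$ is a unit if $st=1$ for some $t\in S$; it is nilpotent if $s^n=0$ for some positive integer $n$. A semiring is completely primary if each of its elements is either a unit or nilpotent. *)

theory Defs
  imports "HOL-Algebra.Ring"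
begin

text \<open>Semirings here are commutative, whereas the multiplication of the HOL-Algebra
  locale \<open>semiring\<close> need not be. The zero semiring is allowed.\<close>

locale commutative_semiring = semiring S + comm_monoid S for S (structure)

definition proper_semiring :: "('a, 'b) ring_scheme \<Rightarrow> bool" where
  "proper_semiring S \<longleftrightarrow> commutative_semiring S \<and> \<not> ring S"

definition nilpotent_elem :: "('a, 'b) ring_scheme \<Rightarrow> 'a \<Rightarrow> bool" where
  "nilpotent_elem S s \<longleftrightarrow> s \<in> carrier S \<and> (\<exists>n::nat. n > 0 \<and> s [^]\<^bsub>S\<^esub> n = \<zero>\<^bsub>S\<^esub>)"

definition completely_primary_semiring :: "('a, 'b) ring_scheme \<Rightarrow> bool" where
  "completely_primary_semiring S \<longleftrightarrow>
     commutative_semiring S \<and> (\<forall>s\<in>carrier S. s \<in> Units S \<or> nilpotent_elem S s)"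

text \<open>The monoid \<open>(P, +, 0)\<close> is given as a HOL-Algebra monoid, so its addition is
  \<open>mult P\<close> and its neutral element \<open>0\<close> is \<open>one P\<close>. The element \<open>e\<close>, meant to lie outside
  the carrier of \<open>P\<close>, is the adjoined \<open>1\<close>.\<close>

definition adjoin_one :: "('a, 'b) monoid_scheme \<Rightarrow> 'a \<Rightarrow> 'a ring" where
  "adjoin_one P e =
     \<lparr> carrier = carrier P \<union> {e},
       mult = (\<lambda>a b. if a = e then b else if b = e then a else \<one>\<^bsub>P\<^esub>),
       one = e,
       zero = \<one>\<^bsub>P\<^esub>,
       add = (\<lambda>a b. if a = e \<or> b = e then e else a \<otimes>\<^bsub>P\<^esub> b) \<rparr>"

end

theory Submission
  imports Defs
begin

text \<open>Addition extended to the adjoined element is again a commutative monoid because that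
  element is absorbing. Multiplication is zero on pairs from \<open>P\<close>, so the only products that
  carry information have a factor \<open>1\<close>, and associativity is immediate. The one point where
  idempotence of \<open>P\<close> matters is distributivity: \<open>a (1 + 1) = a 1 = a\<close> must equal \<open>a + a\<close>.
  Every element is \<open>1\<close> or squares to zero, so the semiring is completely primary, and it is
  not a ring because a sum with the summand \<open>1\<close> equals \<open>1 \<noteq> 0\<close>, so \<open>1\<close> has no additive
  inverse.\<close>

lemma adjoin_one_sel [simp]:
  "carrier (adjoin_one P e) = insert e (carrier P)"
  "a \<otimes>\<^bsub>adjoin_one P e\<^esub> b = (if a = e then b else if b = e then a else \<one>\<^bsub>P\<^esub>)"
  "\<one>\<^bsub>adjoin_one P e\<^esub> = e"
  "\<zero>\<^bsub>adjoin_one P e\<^esub> = \<one>\<^bsub>P\<^esub>"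
  "a \<oplus>\<^bsub>adjoin_one P e\<^esub> b = (if a = e \<or> b = e then e else a \<otimes>\<^bsub>P\<^esub> b)"
  by (auto simp: adjoin_one_def)

lemma commutative_semiring_adjoin_one:
  fixes P :: "('a, 'b) monoid_scheme" and e :: 'a
  assumes "comm_monoid P"
    and idem: "\<And>a. a \<in> carrier P \<Longrightarrow> a \<otimes>\<^bsub>P\<^esub> a = a"
    and e: "e \<notin> carrier P"
  shows "commutative_semiring (adjoin_one P e)"
proof -
  interpret P: comm_monoid P by fact
  \<comment> \<open>Sums and products of elements of \<open>P\<close> stay in \<open>P\<close>, hence never collide with the
    adjoined element in the case distinctions that define the operations.\<close>
  have ne: "a \<otimes>\<^bsub>P\<^esub> b \<noteq> e" if "a \<in> carrier P" "b \<in> carrier P" for a b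
    using that e P.m_closed by metis
  have one_ne: "\<one>\<^bsub>P\<^esub> \<noteq> e"
    using e P.one_closed by metis
  interpret A: abelian_monoid "adjoin_one P e"
    by (rule abelian_monoidI) (use ne one_ne in \<open>auto simp: P.m_ac\<close>)
  interpret M: comm_monoid "adjoin_one P e"
    by (rule comm_monoidI) (use one_ne in auto)
  show ?thesis
    by unfold_locales (use ne one_ne idem in auto)
qed

lemma nilpotent_elem_adjoin_one:
  assumes "a \<in> carrier P" and "e \<notin> carrier P"
  shows "nilpotent_elem (adjoin_one P e) a"
proof -
  have "a [^]\<^bsub>adjoin_one P e\<^esub> (2::nat) = \<zero>\<^bsub>adjoin_one P e\<^esub>"
    using assms by (auto simp: nat_pow_def numeral_2_eq_2)
  then show ?thesis
    using assms(1) unfolding nilpotent_elem_def by (auto intro!: exI[of _ "2::nat"])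
qed

lemma not_ring_adjoin_one:
  assumes "monoid P" and "e \<notin> carrier P"
  shows "\<not> ring (adjoin_one P e)"
proof
  assume "ring (adjoin_one P e)"
  then interpret R: ring "adjoin_one P e" .
  have "e \<oplus>\<^bsub>adjoin_one P e\<^esub> (\<ominus>\<^bsub>adjoin_one P e\<^esub> e) = \<zero>\<^bsub>adjoin_one P e\<^esub>"
    by (rule R.r_neg) simp
  then have "e = \<one>\<^bsub>P\<^esub>"
    by simp
  then show False
    using assms monoid.one_closed by metis
qed

theorem proposition4p5:
  fixes P :: "('a, 'b) monoid_scheme" and e :: 'a
  assumes "comm_monoid P"
    and "\<And>a. a \<in> carrier P \<Longrightarrow> a \<otimes>\<^bsub>P\<^esub> a = a"
    and "e \<notin> carrier P"
  shows "completely_primary_semiring (adjoin_one P e) \<and> proper_semiring (adjoin_one P e)"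
proof -
  have S: "commutative_semiring (adjoin_one P e)"
    using assms by (rule commutative_semiring_adjoin_one)
  have "s \<in> Units (adjoin_one P e) \<or> nilpotent_elem (adjoin_one P e) s"
    if "s \<in> carrier (adjoin_one P e)" for s
    using that nilpotent_elem_adjoin_one[OF _ assms(3)] by (auto simp: Units_def)
  moreover have "\<not> ring (adjoin_one P e)"
    using assms(1,3) by (intro not_ring_adjoin_one comm_monoid.axioms(1))
  ultimately show ?thesis
    using S unfolding completely_primary_semiring_def proper_semiring_def by blast
qed

end
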